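(* Let $g_0,g_1,g_2$ be smooth real functions of $t$, let $r=-1/2$, $s=i/2$, and let $\mathfrak{sl}(2,\mathbb R)$ act on $I'(q,r,s)_\mu$ by letting the standard triple $\{h,e^+,e^-\}$ act by the differential operators $\{L_3,L_2,L_1\}$ given in the context. Then the Casimir element $\Omega=\frac12h^2-h+2e^+e^-$ acts by $$\Omega=\frac12\left[(x-\chi_1\mathcal C_2+\chi_2\mathcal C_1)^2\left(\Box-2(g_2(t)x^2+g_1(t)x+g_0(t))\right)-\frac34\right],\qquad \Box=2i\partial_t+\partial_x^2.$$ In particular, with $\Omega'=2\Omega-r(r+2)$, $$\ker\Omega'=\ker\left(\Box-2(g_2(t)x^2+g_1(t)x+g_0(t))\right)$$ in $I'(q,r,s)_\mu$. If $\lambda\in\mathbb R$, $\lambda\neq0$ and $g_1\equiv0$ (which is forced by the standing condition $\lambda\cdot g_1=0$), then $\Omega'$ acts by $\Omega'=x^2\left(\Box-2(g_2(t)x^2+g_0(t))\right)$, and thus $$\ker(\Omega'-2\lambda)=\ker\left(\Box-2\left(g_2(t)x^2+g_0(t)+\lambda/x^2\right)\right)$$ in $I'(q,r,s)_\mu$.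
   Context: Consider potentials $V(t,x)=g_2(t)x^2+g_1(t)x+g_0(t)+\lambda/x^2$ with $\lambda\cdot g_1(t)=0$. Let $\chi_1,\chi_2$ be real, linearly independent solutions of $b''+2g_2b=0$ with $W(\chi_1,\chi_2)=\chi_1\chi_2'-\chi_2\chi_1'=1$. Put $\varphi_1=\chi_1^2$, $\varphi_2=\chi_2^2$, $\varphi_3=2\chi_1\chi_2$; $\mathcal C_j(t)=\int_0^t\chi_jg_1$ for $j=1,2$; $\mathcal A_1=-\chi_1\mathcal C_1$, $\mathcal A_2=-\chi_2\mathcal C_2$, $\mathcal A_3=-(\chi_1\mathcal C_2+\chi_2\mathcal C_1)$; $\mathcal D_1=-\frac12\mathcal C_1^2$, $\mathcal D_2=-\frac12\mathcal C_2^2$, $\mathcal D_3=-\mathcal C_1\mathcal C_2$; and, for $j=1,2,3$, $$\mathcal B_j=-\tfrac14i\varphi_j''x^2-i\mathcal A_j'x+\tfrac14\varphi_j'+ig_0\varphi_j+i\mathcal D_j,$$ $$L_j=(-1)^{j+1}\left(\varphi_j\partial_t+\left(\tfrac12\varphi_j'x+\mathcal A_j\right)\partial_x+\mathcal B_j\right).$$ These satisfy $[L_3,L_1]=-2L_1$, $[L_3,L_2]=2L_2$, $[L_2,L_1]=L_3$. $I'(q,r,s)_\mu$ is a space of smooth functions of $(t,x)$: it is the image of the non-compact picture $I'(q,r,s)$ of the representation of $\widetilde{SL(2,\mathbb R)}\ltimes H_3$ smoothly induced from the character $\chi_{q,r,s}$ of a parabolic-like subgroup, under a (local) intertwining map of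 the form $f\mapsto\tilde f$, $\tilde f(t,x)=\rho(t,x)f(\gamma(t,x))$, with $\rho$ a nowhere vanishing multiplier and $\gamma(t,x)=\left(\int_0^t\chi_2^{-2},\ \frac{x}{\chi_2(t)}+\int_0^t\mathcal C_2\chi_2^{-2}\right)$, for which the triple $\{h,e^+,e^-\}$ acts by $\{L_3,L_2,L_1\}$. For the present statement only the following matters: $I'(q,r,s)_\mu$ is a linear space of smooth functions, stable under $L_1,L_2,L_3$, on which $\{h,e^+,e^-\}$ acts by $\{L_3,L_2,L_1\}$; the kernels are taken in this space, and equations involving $\lambda/x^2$ are understood for $x\ne0$. *)

theory Defs
  imports "HOL-Analysis.Analysis"
begin

section \<open>Smooth functions and partial derivatives\<close>

definition smooth_real :: "(real \<Rightarrow> real) \<Rightarrow> bool" where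
  "smooth_real g \<longleftrightarrow> (\<forall>n t. (deriv ^^ n) g field_differentiable (at t))"

text \<open>Points of the plane are pairs \<open>(t, x)\<close>.\<close>

type_synonym wavefun = "real \<times> real \<Rightarrow> complex"

definition dt :: "wavefun \<Rightarrow> wavefun" where
  "dt f = (\<lambda>(t, x). vector_derivative (\<lambda>\<tau>. f (\<tau>, x)) (at t))"

definition dx :: "wavefun \<Rightarrow> wavefun" where
  "dx f = (\<lambda>(t, x). vector_derivative (\<lambda>\<xi>. f (t, \<xi>)) (at x))"

primrec C_k_on :: "nat \<Rightarrow> (real \<times> real) set \<Rightarrow> wavefun \<Rightarrow> bool" where
  "C_k_on 0 U f \<longleftrightarrow> continuous_on U f"
| "C_k_on (Suc k) U f \<longleftrightarrow>
     (\<forall>p\<in>U. f differentiable (at p)) \<and> C_k_on k U (dt f) \<and> C_k_on k U (dx f)"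

definition smooth_on :: "(real \<times> real) set \<Rightarrow> wavefun \<Rightarrow> bool" where
  "smooth_on U f \<longleftrightarrow> (\<forall>k. C_k_on k U f)"

text \<open>Functions are total, but only their values on the open set \<open>U\<close> matter: a space of
  functions on \<open>U\<close> is represented by the set of all total extensions of its members, so
  the values off \<open>U\<close> are unconstrained.\<close>

definition smooth_function_space :: "(real \<times> real) set \<Rightarrow> wavefun set \<Rightarrow> bool" where
  "smooth_function_space U I \<longleftrightarrow>
     (\<forall>f\<in>I. smooth_on U f) \<and>
     (\<lambda>p. 0) \<in> I \<and>
     (\<forall>f\<in>I. \<forall>g\<in>I. (\<lambda>p. f p + g p) \<in> I) \<and>
     (\<forall>c. \<forall>f\<in>I. (\<lambda>p. c * f p) \<in> I)"

text \<open>The kernel, in the space \<open>I\<close>, of an operator whose equation is imposed at the points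
  of \<open>S\<close>.\<close>

definition ker_on ::
  "(real \<times> real) set \<Rightarrow> wavefun set \<Rightarrow> (wavefun \<Rightarrow> wavefun) \<Rightarrow> wavefun set" where
  "ker_on S I D = {f \<in> I. \<forall>p\<in>S. D f p = 0}"

section \<open>The Schroedinger operator\<close>

definition box :: "wavefun \<Rightarrow> wavefun" where
  "box f = (\<lambda>p. 2 * \<i> * dt f p + dx (dx f) p)"

definition schroedinger :: "(real \<Rightarrow> real \<Rightarrow> real) \<Rightarrow> wavefun \<Rightarrow> wavefun" where
  "schroedinger V f = (\<lambda>(t, x). box f (t, x) - 2 * complex_of_real (V t x) * f (t, x))"

section \<open>The operators \<open>L\<^sub>j\<close>\<close>

definition solves_ode2 :: "(real \<Rightarrow> real) \<Rightarrow> (real \<Rightarrow> real) \<Rightarrow> bool" where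
  "solves_ode2 g2 b \<longleftrightarrow>
     (\<exists>b'. \<forall>t. (b has_real_derivative b' t) (at t) \<and>
               (b' has_real_derivative - 2 * g2 t * b t) (at t))"

definition lin_indep :: "(real \<Rightarrow> real) \<Rightarrow> (real \<Rightarrow> real) \<Rightarrow> bool" where
  "lin_indep u v \<longleftrightarrow> (\<forall>a b. (\<forall>t. a * u t + b * v t = 0) \<longrightarrow> a = 0 \<and> b = 0)"

definition wronskian :: "(real \<Rightarrow> real) \<Rightarrow> (real \<Rightarrow> real) \<Rightarrow> real \<Rightarrow> real" where
  "wronskian u v t = u t * deriv v t - v t * deriv u t"

text \<open>The families indexed by \<open>j \<in> {1, 2, 3}\<close> take the value for \<open>j = 3\<close> at all other
  indices; these are never used.  The interval integral is oriented, so \<open>t < 0\<close> is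
  covered.\<close>

definition intC :: "(real \<Rightarrow> real) \<Rightarrow> (real \<Rightarrow> real) \<Rightarrow> real \<Rightarrow> real" where
  "intC g1 u t = (LBINT s=ereal 0..ereal t. u s * g1 s)"

definition phi :: "(real \<Rightarrow> real) \<Rightarrow> (real \<Rightarrow> real) \<Rightarrow> nat \<Rightarrow> real \<Rightarrow> real" where
  "phi \<chi>1 \<chi>2 j t =
     (if j = 1 then (\<chi>1 t)\<^sup>2
      else if j = 2 then (\<chi>2 t)\<^sup>2
      else 2 * \<chi>1 t * \<chi>2 t)"

definition coeffA ::
  "(real \<Rightarrow> real) \<Rightarrow> (real \<Rightarrow> real) \<Rightarrow> (real \<Rightarrow> real) \<Rightarrow> nat \<Rightarrow> real \<Rightarrow> real" where
  "coeffA g1 \<chi>1 \<chi>2 j t =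
     (if j = 1 then - \<chi>1 t * intC g1 \<chi>1 t
      else if j = 2 then - \<chi>2 t * intC g1 \<chi>2 t
      else - (\<chi>1 t * intC g1 \<chi>2 t + \<chi>2 t * intC g1 \<chi>1 t))"

definition coeffD ::
  "(real \<Rightarrow> real) \<Rightarrow> (real \<Rightarrow> real) \<Rightarrow> (real \<Rightarrow> real) \<Rightarrow> nat \<Rightarrow> real \<Rightarrow> real" where
  "coeffD g1 \<chi>1 \<chi>2 j t =
     (if j = 1 then - (1/2) * (intC g1 \<chi>1 t)\<^sup>2
      else if j = 2 then - (1/2) * (intC g1 \<chi>2 t)\<^sup>2
      else - (intC g1 \<chi>1 t * intC g1 \<chi>2 t))"

definition coeffB ::
  "(real \<Rightarrow> real) \<Rightarrow> (real \<Rightarrow> real) \<Rightarrow> (real \<Rightarrow> real) \<Rightarrow> (real \<Rightarrow> real) \<Rightarrow> nat \<Rightarrow> wavefun" where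
  "coeffB g0 g1 \<chi>1 \<chi>2 j = (\<lambda>(t, x).
     - (1/4) * \<i> * of_real (deriv (deriv (phi \<chi>1 \<chi>2 j)) t) * of_real x ^ 2
     - \<i> * of_real (deriv (coeffA g1 \<chi>1 \<chi>2 j) t) * of_real x
     + (1/4) * of_real (deriv (phi \<chi>1 \<chi>2 j) t)
     + \<i> * of_real (g0 t) * of_real (phi \<chi>1 \<chi>2 j t)
     + \<i> * of_real (coeffD g1 \<chi>1 \<chi>2 j t))"

definition opL ::
  "(real \<Rightarrow> real) \<Rightarrow> (real \<Rightarrow> real) \<Rightarrow> (real \<Rightarrow> real) \<Rightarrow> (real \<Rightarrow> real) \<Rightarrow> nat
     \<Rightarrow> wavefun \<Rightarrow> wavefun" where
  "opL g0 g1 \<chi>1 \<chi>2 j f = (\<lambda>(t, x). (-1) ^ (j + 1) *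
     (of_real (phi \<chi>1 \<chi>2 j t) * dt f (t, x)
      + of_real ((1/2) * deriv (phi \<chi>1 \<chi>2 j) t * x + coeffA g1 \<chi>1 \<chi>2 j t) * dx f (t, x)
      + coeffB g0 g1 \<chi>1 \<chi>2 j (t, x) * f (t, x)))"

section \<open>The action of \<open>sl(2, \<real>)\<close> and the Casimir element\<close>

definition sl2_h :: "real^2^2" where
  "sl2_h = vector [vector [1, 0], vector [0, -1]]"

definition sl2_e_plus :: "real^2^2" where
  "sl2_e_plus = vector [vector [0, 1], vector [0, 0]]"

definition sl2_e_minus :: "real^2^2" where
  "sl2_e_minus = vector [vector [0, 0], vector [1, 0]]"

text \<open>A traceless matrix \<open>X\<close> equals \<open>X\<^sub>1\<^sub>1 h + X\<^sub>1\<^sub>2 e\<^sup>+ + X\<^sub>2\<^sub>1 e\<^sup>-\<close>; the action is the linear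
  extension of \<open>h \<mapsto> L\<^sub>3\<close>, \<open>e\<^sup>+ \<mapsto> L\<^sub>2\<close>, \<open>e\<^sup>- \<mapsto> L\<^sub>1\<close>.\<close>

definition sl2_act ::
  "(real \<Rightarrow> real) \<Rightarrow> (real \<Rightarrow> real) \<Rightarrow> (real \<Rightarrow> real) \<Rightarrow> (real \<Rightarrow> real)
     \<Rightarrow> real^2^2 \<Rightarrow> wavefun \<Rightarrow> wavefun" where
  "sl2_act g0 g1 \<chi>1 \<chi>2 X f = (\<lambda>p.
     of_real (X $ 1 $ 1) * opL g0 g1 \<chi>1 \<chi>2 3 f p
     + of_real (X $ 1 $ 2) * opL g0 g1 \<chi>1 \<chi>2 2 f p
     + of_real (X $ 2 $ 1) * opL g0 g1 \<chi>1 \<chi>2 1 f p)"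

lemma sl2_act_triple:
  "sl2_act g0 g1 \<chi>1 \<chi>2 sl2_h = opL g0 g1 \<chi>1 \<chi>2 3"
  "sl2_act g0 g1 \<chi>1 \<chi>2 sl2_e_plus = opL g0 g1 \<chi>1 \<chi>2 2"
  "sl2_act g0 g1 \<chi>1 \<chi>2 sl2_e_minus = opL g0 g1 \<chi>1 \<chi>2 1"
  by (auto simp: fun_eq_iff sl2_act_def sl2_h_def sl2_e_plus_def sl2_e_minus_def vector_2)

text \<open>The action of \<open>\<Omega> = (1/2) h\<^sup>2 - h + 2 e\<^sup>+ e\<^sup>-\<close> and of \<open>\<Omega>' = 2 \<Omega> - r (r + 2)\<close> in the
  extension to the universal enveloping algebra of an action \<open>\<rho>\<close> of \<open>sl(2, \<real>)\<close>.\<close>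

definition casimir :: "(real^2^2 \<Rightarrow> wavefun \<Rightarrow> wavefun) \<Rightarrow> wavefun \<Rightarrow> wavefun" where
  "casimir \<rho> f = (\<lambda>p.
     (1/2) * \<rho> sl2_h (\<rho> sl2_h f) p - \<rho> sl2_h f p
     + 2 * \<rho> sl2_e_plus (\<rho> sl2_e_minus f) p)"

definition casimir' ::
  "complex \<Rightarrow> (real^2^2 \<Rightarrow> wavefun \<Rightarrow> wavefun) \<Rightarrow> wavefun \<Rightarrow> wavefun" where
  "casimir' r \<rho> f = (\<lambda>p. 2 * casimir \<rho> f p - r * (r + 2) * f p)"

end

theory Submission
  imports Defs
begin

text \<open>Write \<open>V\<close> for the quadratic potential and \<open>u\<^sub>j = \<chi>\<^sub>j' x - \<C>\<^sub>j\<close>, so that \<open>\<partial>\<^sub>x u\<^sub>j = \<chi>\<^sub>j'\<close> and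
  \<open>\<partial>\<^sub>t u\<^sub>j = - \<chi>\<^sub>j \<partial>\<^sub>x V\<close>.  Then \<open>L\<^sub>1 = K\<^sub>1\<^sub>1\<close>, \<open>L\<^sub>2 = - K\<^sub>2\<^sub>2\<close> and \<open>L\<^sub>3 = 2 K\<^sub>1\<^sub>2\<close>, where
  \<open>K\<^sub>j\<^sub>k = \<chi>\<^sub>j \<chi>\<^sub>k (\<partial>\<^sub>t + i V) + (\<chi>\<^sub>j u\<^sub>k + \<chi>\<^sub>k u\<^sub>j) \<partial>\<^sub>x / 2 + (\<chi>\<^sub>j \<chi>\<^sub>k)' / 4 - i u\<^sub>j u\<^sub>k / 2\<close>.
  Up to the symmetry of the mixed partial derivatives, the formula for
  \<open>\<Omega> = 2 (K\<^sub>1\<^sub>2 K\<^sub>1\<^sub>2 - K\<^sub>2\<^sub>2 K\<^sub>1\<^sub>1) - 2 K\<^sub>1\<^sub>2\<close> is a polynomial identity in \<open>\<chi>\<^sub>j\<close>, \<open>\<chi>\<^sub>j'\<close>, \<open>u\<^sub>j\<close> and the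
  derivatives of \<open>V\<close> and \<open>f\<close>.  The factor \<open>\<chi>\<^sub>1 u\<^sub>2 - \<chi>\<^sub>2 u\<^sub>1 = x - \<chi>\<^sub>1 \<C>\<^sub>2 + \<chi>\<^sub>2 \<C>\<^sub>1\<close> vanishes for only
  one \<open>x\<close> at each \<open>t\<close>, so by continuity it does not affect the kernel; at \<open>x = 0\<close> the equation with
  \<open>\<lambda> / x\<^sup>2\<close> is treated in the same way.\<close>

section \<open>Symmetry of the mixed partial derivatives\<close>

text \<open>The second difference of \<open>f\<close> over the corners of a square of side
  \<open>h\<close> can be grouped in two ways. Two uses of the mean value theorem for each grouping
  make it \<open>h * h\<close> times a value of \<open>ftx\<close>, and also \<open>h * h\<close>
  times a value of \<open>fxt\<close>, inside the square. Continuity at the corner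
  \<open>(t0, x0)\<close> then excludes different values there.\<close>

lemma mixed_partials_eq_real:
  fixes f ft fx ftx fxt :: "real \<times> real \<Rightarrow> real"
  assumes U: "open U" "(t0, x0) \<in> U"
    and ft: "\<And>t x. (t, x) \<in> U \<Longrightarrow> ((\<lambda>\<tau>. f (\<tau>, x)) has_real_derivative ft (t, x)) (at t)"
    and fx: "\<And>t x. (t, x) \<in> U \<Longrightarrow> ((\<lambda>\<xi>. f (t, \<xi>)) has_real_derivative fx (t, x)) (at x)"
    and ftx: "\<And>t x. (t, x) \<in> U \<Longrightarrow> ((\<lambda>\<xi>. ft (t, \<xi>)) has_real_derivative ftx (t, x)) (at x)"
    and fxt: "\<And>t x. (t, x) \<in> U \<Longrightarrow> ((\<lambda>\<tau>. fx (\<tau>, x)) has_real_derivative fxt (t, x)) (at t)"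
    and cont: "continuous_on U ftx" "continuous_on U fxt"
  shows "ftx (t0, x0) = fxt (t0, x0)"
proof (rule ccontr)
  assume ne: "ftx (t0, x0) \<noteq> fxt (t0, x0)"
  \<comment> \<open>Half the gap: values within \<epsilon> of the two sides cannot coincide.\<close>
  define \<epsilon> where "\<epsilon> = \<bar>ftx (t0, x0) - fxt (t0, x0)\<bar> / 2"
  have \<epsilon>: "\<epsilon> > 0" using ne by (simp add: \<epsilon>_def)
  have "isCont ftx (t0, x0)" "isCont fxt (t0, x0)"
    using cont U continuous_on_eq_continuous_at by blast+
  then obtain d1 d2 where
      d1: "d1 > 0" "\<And>p. dist p (t0, x0) < d1 \<Longrightarrow> dist (ftx p) (ftx (t0, x0)) < \<epsilon>"
    and d2: "d2 > 0" "\<And>p. dist p (t0, x0) < d2 \<Longrightarrow> dist (fxt p) (fxt (t0, x0)) < \<epsilon>"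
    using \<epsilon> unfolding continuous_at_eps_delta by metis
  obtain e where e: "e > 0" "ball (t0, x0) e \<subseteq> U"
    using U by (meson open_contains_ball)
  define d where "d = min e (min d1 d2)"
  \<comment> \<open>Points of the square are at distance at most \<open>2 * h\<close> from the
    corner, which has to stay below \<open>d\<close>.\<close>
  define h where "h = d / 3"
  have d: "d > 0" "d \<le> e" "d \<le> d1" "d \<le> d2" using d1 d2 e by (auto simp: d_def)
  have h: "h > 0" using d by (simp add: h_def)
  have near: "dist (t, x) (t0, x0) < d" if "t0 \<le> t" "t \<le> t0 + h" "x0 \<le> x" "x \<le> x0 + h" for t x
  proof -
    have "dist (t, x) (t0, x0) \<le> dist t t0 + dist x x0"
      unfolding dist_prod_def using sqrt_sum_squares_le_sum_abs[of "dist t t0" "dist x x0"] by simp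
    also have "\<dots> < d" using that d by (simp add: dist_real_def h_def)
    finally show ?thesis .
  qed
  have inU: "(t, x) \<in> U" if "t0 \<le> t" "t \<le> t0 + h" "x0 \<le> x" "x \<le> x0 + h" for t x
    using near[OF that] d e by (auto simp: dist_commute)
  define \<Delta> where "\<Delta> = f (t0 + h, x0 + h) - f (t0 + h, x0) - (f (t0, x0 + h) - f (t0, x0))"
  have "\<exists>\<xi>>t0. \<xi> < t0 + h \<and> (f (t0 + h, x0 + h) - f (t0 + h, x0)) - (f (t0, x0 + h) - f (t0, x0))
          = (t0 + h - t0) * (ft (\<xi>, x0 + h) - ft (\<xi>, x0))"
    by (rule MVT2[where f = "\<lambda>t. f (t, x0 + h) - f (t, x0)"])
      (use h in \<open>auto intro!: DERIV_diff ft inU\<close>)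
  then obtain \<xi> where \<xi>: "t0 < \<xi>" "\<xi> < t0 + h" "\<Delta> = h * (ft (\<xi>, x0 + h) - ft (\<xi>, x0))"
    by (auto simp: \<Delta>_def)
  have "\<exists>\<eta>>x0. \<eta> < x0 + h \<and> ft (\<xi>, x0 + h) - ft (\<xi>, x0) = (x0 + h - x0) * ftx (\<xi>, \<eta>)"
    by (rule MVT2[where f = "\<lambda>x. ft (\<xi>, x)"]) (use h \<xi> in \<open>auto intro!: ftx inU\<close>)
  then obtain \<eta> where \<eta>: "x0 < \<eta>" "\<eta> < x0 + h" "\<Delta> = h * (h * ftx (\<xi>, \<eta>))"
    using \<xi> by auto
  have "\<exists>\<eta>>x0. \<eta> < x0 + h \<and> (f (t0 + h, x0 + h) - f (t0, x0 + h)) - (f (t0 + h, x0) - f (t0, x0))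
          = (x0 + h - x0) * (fx (t0 + h, \<eta>) - fx (t0, \<eta>))"
    by (rule MVT2[where f = "\<lambda>x. f (t0 + h, x) - f (t0, x)"])
      (use h in \<open>auto intro!: DERIV_diff fx inU\<close>)
  then obtain \<eta>' where \<eta>': "x0 < \<eta>'" "\<eta>' < x0 + h" "\<Delta> = h * (fx (t0 + h, \<eta>') - fx (t0, \<eta>'))"
    by (auto simp: \<Delta>_def algebra_simps)
  have "\<exists>\<xi>>t0. \<xi> < t0 + h \<and> fx (t0 + h, \<eta>') - fx (t0, \<eta>') = (t0 + h - t0) * fxt (\<xi>, \<eta>')"
    by (rule MVT2[where f = "\<lambda>t. fx (t, \<eta>')"]) (use h \<eta>' in \<open>auto intro!: fxt inU\<close>)
  then obtain \<xi>' where \<xi>': "t0 < \<xi>'" "\<xi>' < t0 + h" "\<Delta> = h * (h * fxt (\<xi>', \<eta>'))"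
    using \<eta>' by auto
  have "ftx (\<xi>, \<eta>) = fxt (\<xi>', \<eta>')" using \<eta>(3) \<xi>'(3) h by simp
  moreover have "dist (ftx (t0, x0)) (ftx (\<xi>, \<eta>)) < \<epsilon>"
    using near[of \<xi> \<eta>] \<xi> \<eta> d by (subst dist_commute, intro d1) auto
  moreover have "dist (fxt (t0, x0)) (fxt (\<xi>', \<eta>')) < \<epsilon>"
    using near[of \<xi>' \<eta>'] \<xi>' \<eta>' d by (subst dist_commute, intro d2) auto
  ultimately have "dist (ftx (t0, x0)) (fxt (t0, x0)) < \<epsilon> + \<epsilon>"
    using dist_triangle_less_add by metis
  then show False by (simp add: \<epsilon>_def dist_real_def)
qed

lemma smooth_on_dt: "smooth_on U f \<Longrightarrow> smooth_on U (dt f)"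
  and smooth_on_dx: "smooth_on U f \<Longrightarrow> smooth_on U (dx f)"
  unfolding smooth_on_def using C_k_on.simps(2) by blast+

lemma smooth_on_continuous: "smooth_on U f \<Longrightarrow> continuous_on U f"
  unfolding smooth_on_def using C_k_on.simps(1) by blast

lemma smooth_on_differentiable: "smooth_on U f \<Longrightarrow> p \<in> U \<Longrightarrow> f differentiable (at p)"
  unfolding smooth_on_def using C_k_on.simps(2)[of 0] by blast

lemma has_vector_derivative_dt:
  assumes "smooth_on U f" "(t, x) \<in> U"
  shows "((\<lambda>\<tau>. f (\<tau>, x)) has_vector_derivative dt f (t, x)) (at t)"
proof -
  have "f differentiable (at (t, x))" using assms by (rule smooth_on_differentiable)
  moreover have "(\<lambda>\<tau>. (\<tau>, x)) differentiable (at t)"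
    unfolding differentiable_def by (auto intro!: exI derivative_eq_intros)
  ultimately have "(\<lambda>\<tau>. f (\<tau>, x)) differentiable (at t)"
    using differentiable_chain_at[of "\<lambda>\<tau>. (\<tau>, x)" t f] by (simp add: comp_def)
  then show ?thesis by (simp add: dt_def vector_derivative_works)
qed

lemma has_vector_derivative_dx:
  assumes "smooth_on U f" "(t, x) \<in> U"
  shows "((\<lambda>\<xi>. f (t, \<xi>)) has_vector_derivative dx f (t, x)) (at x)"
proof -
  have "f differentiable (at (t, x))" using assms by (rule smooth_on_differentiable)
  moreover have "(\<lambda>\<xi>. (t, \<xi>)) differentiable (at x)"
    unfolding differentiable_def by (auto intro!: exI derivative_eq_intros)
  ultimately have "(\<lambda>\<xi>. f (t, \<xi>)) differentiable (at x)"
    using differentiable_chain_at[of "\<lambda>\<xi>. (t, \<xi>)" x f] by (simp add: comp_def)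
  then show ?thesis by (simp add: dx_def vector_derivative_works)
qed

text \<open>The mean value theorem concerns real values, so the real and imaginary parts are treated
  separately.\<close>

lemma mixed_partials_eq:
  assumes U: "open U" "p \<in> U" and f: "smooth_on U f"
  shows "dx (dt f) p = dt (dx f) p"
proof -
  obtain t x where p: "p = (t, x)" by fastforce
  have *: "R (dx (dt f) p) = R (dt (dx f) p)" if R: "bounded_linear R" for R :: "complex \<Rightarrow> real"
  proof -
    have der: "((\<lambda>z. R (g z)) has_real_derivative R g') F"
      if "(g has_vector_derivative g') F" for g :: "real \<Rightarrow> complex" and g' F
      using bounded_linear.has_vector_derivative[OF R that]
      by (simp add: has_real_derivative_iff_has_vector_derivative)
    show ?thesis unfolding p
      by (rule mixed_partials_eq_real[OF U(1) U(2)[unfolded p], of "\<lambda>p. R (f p)"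
            "\<lambda>p. R (dt f p)" "\<lambda>p. R (dx f p)"])
        (auto intro!: der has_vector_derivative_dt has_vector_derivative_dx smooth_on_dt smooth_on_dx
            smooth_on_continuous bounded_linear.continuous_on[OF R] f)
  qed
  show ?thesis using *[OF bounded_linear_Re] *[OF bounded_linear_Im] by (simp add: complex_eq_iff)
qed

section \<open>Derivatives of the coefficients and the polynomial identity\<close>

lemma has_real_derivative_intC:
  assumes "continuous_on UNIV b" "continuous_on UNIV g1"
  shows "(intC g1 b has_real_derivative b t * g1 t) (at t)"
proof -
  \<comment> \<open>\<open>{-M..M}\<close> has both \<open>0\<close> and \<open>t\<close> in its
    interior, whatever the sign of \<open>t\<close>.\<close>
  define M where "M = \<bar>t\<bar> + 1"
  have M: "-M < 0" "0 < M" "-M < t" "t < M" by (auto simp: M_def)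
  have "((\<lambda>u. LBINT s=ereal 0..ereal u. b s * g1 s) has_vector_derivative b t * g1 t) (at t within {-M..M})"
    using assms M by (intro interval_integral_FTC2 continuous_on_mult)
      (auto intro: continuous_on_subset)
  moreover have "at t within {-M..M} = at t"
    using M by (intro at_within_interior) auto
  ultimately show ?thesis
    by (simp add: has_real_derivative_iff_has_vector_derivative intC_def[abs_def])
qed

lemma smooth_real_has_real_derivative:
  "smooth_real g \<Longrightarrow> (g has_real_derivative deriv g t) (at t)"
  unfolding smooth_real_def
  by (metis DERIV_deriv_iff_field_differentiable funpow_0)

text \<open>Here \<open>\<sigma>\<close> stands for \<open>- i\<close>; the relation \<open>\<sigma>\<^sup>2 = - 1\<close> enters only through the form of the
  Schroedinger operator.  Both sides are made homogeneous by powers of the Wronskian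
  \<open>b c' - c b'\<close>.\<close>

lemma casimir_identity:
  fixes b c b' c' u v \<sigma> V Vt Vx g f ft fx ftt ftx fxx :: complex
  defines "K12 \<equiv> 4 * b * c * (ft - \<sigma> * V * f) + 2 * (b * v + c * u) * fx
      + (b' * c + b * c' + 2 * \<sigma> * u * v) * f"
    and "K12t \<equiv> 4 * (b' * c + b * c') * (ft - \<sigma> * V * f)
      + 4 * b * c * (ftt - \<sigma> * (Vt * f + V * ft))
      + 2 * (b' * v + c' * u - 2 * b * c * Vx) * fx + 2 * (b * v + c * u) * ftx
      + (2 * b' * c' - 4 * g * b * c - 2 * \<sigma> * Vx * (b * v + c * u)) * f
      + (b' * c + b * c' + 2 * \<sigma> * u * v) * ft"
    and "K12x \<equiv> 4 * b * c * (ftx - \<sigma> * (Vx * f + V * fx))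
      + 2 * (b' * c + b * c') * fx + 2 * (b * v + c * u) * fxx
      + 2 * \<sigma> * (b' * v + c' * u) * f
      + (b' * c + b * c' + 2 * \<sigma> * u * v) * fx"
    and "K11 \<equiv> 4 * b * b * (ft - \<sigma> * V * f) + 4 * b * u * fx
      + (2 * b * b' + 2 * \<sigma> * u * u) * f"
    and "K11t \<equiv> 8 * b * b' * (ft - \<sigma> * V * f)
      + 4 * b * b * (ftt - \<sigma> * (Vt * f + V * ft))
      + 4 * (b' * u - b * b * Vx) * fx + 4 * b * u * ftx
      + (2 * b' * b' - 4 * g * b * b - 4 * \<sigma> * Vx * b * u) * f
      + (2 * b * b' + 2 * \<sigma> * u * u) * ft"
    and "K11x \<equiv> 4 * b * b * (ftx - \<sigma> * (Vx * f + V * fx))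
      + 4 * b * b' * fx + 4 * b * u * fxx
      + 4 * \<sigma> * b' * u * f
      + (2 * b * b' + 2 * \<sigma> * u * u) * fx"
  shows "4 * b * c * (K12t - \<sigma> * V * K12) + 2 * (b * v + c * u) * K12x
           + (b' * c + b * c' + 2 * \<sigma> * u * v) * K12
         - 4 * (b * c' - c * b') * K12
         - (4 * c * c * (K11t - \<sigma> * V * K11) + 4 * c * v * K11x
           + (2 * c * c' + 2 * \<sigma> * v * v) * K11)
       = (b * v - c * u)\<^sup>2 * (4 * fxx - 8 * \<sigma> * (ft - \<sigma> * V * f))
           - 3 * (b * c' - c * b')\<^sup>2 * f"
  unfolding assms by algebra

section \<open>The operators \<open>4 K\<^sub>j\<^sub>k\<close> and their Casimir
  combination\<close>

locale potential =
  fixes V V_t V_x :: "real \<Rightarrow> real \<Rightarrow> real" and g2 :: "real \<Rightarrow> real"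
  assumes V_t: "\<And>t x. ((\<lambda>\<tau>. V \<tau> x) has_real_derivative V_t t x) (at t)"
    and V_x: "\<And>t x. (V t has_real_derivative V_x t x) (at x)"
begin

text \<open>The last two equations with \<open>b' = db/dt\<close> make
  \<open>P = b d/dx - i u\<close> commute formally with \<open>schroedinger V\<close>, so these are
  the Heisenberg symmetries; \<open>K\<^sub>j\<^sub>k\<close> is \<open>i/2\<close> times the
  symmetrized product of \<open>P\<^sub>j\<close> and \<open>P\<^sub>k\<close> minus
  \<open>\<chi>\<^sub>j \<chi>\<^sub>k\<close> times the Schroedinger operator. For a quadratic
  \<open>V\<close> with leading coefficient \<open>g2\<close>, the equation for \<open>b'\<close> is
  the compatibility of the two derivatives of \<open>u\<close>.\<close>

definition symbol :: "(real \<Rightarrow> real) \<Rightarrow> (real \<Rightarrow> real) \<Rightarrow> (real \<Rightarrow> real \<Rightarrow> real) \<Rightarrow> bool" where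
  "symbol b b' u \<longleftrightarrow> (\<forall>t x.
     (b has_real_derivative b' t) (at t) \<and>
     (b' has_real_derivative - 2 * g2 t * b t) (at t) \<and>
     ((\<lambda>\<tau>. u \<tau> x) has_real_derivative - b t * V_x t x) (at t) \<and>
     (u t has_real_derivative b' t) (at x))"

text \<open>This is \<open>4 K\<^sub>j\<^sub>k\<close>: the factor clears denominators.\<close>

definition symbol_op ::
  "(real \<Rightarrow> real) \<Rightarrow> (real \<Rightarrow> real) \<Rightarrow> (real \<Rightarrow> real \<Rightarrow> real) \<Rightarrow>
   (real \<Rightarrow> real) \<Rightarrow> (real \<Rightarrow> real) \<Rightarrow> (real \<Rightarrow> real \<Rightarrow> real) \<Rightarrow> wavefun \<Rightarrow> wavefun" where
  "symbol_op b b' u c c' v f = (\<lambda>(t, x).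
     4 * of_real (b t) * of_real (c t) * (dt f (t, x) - (- \<i>) * of_real (V t x) * f (t, x))
     + 2 * (of_real (b t) * of_real (v t x) + of_real (c t) * of_real (u t x)) * dx f (t, x)
     + (of_real (b' t) * of_real (c t) + of_real (b t) * of_real (c' t)
         + 2 * (- \<i>) * of_real (u t x) * of_real (v t x)) * f (t, x))"

text \<open>The derivative is arranged as \<open>K12t\<close> in \<open>casimir_identity\<close>
  with \<sigma> equal to \<open>- \<i>\<close>; taking \<open>c = b\<close> yields
  \<open>K11t\<close>.\<close>

lemma symbol_op_dt:
  assumes f: "smooth_on U f" "(t, x) \<in> U" and b: "symbol b b' u" and c: "symbol c c' v"
  shows "((\<lambda>\<tau>. symbol_op b b' u c c' v f (\<tau>, x)) has_vector_derivative
     4 * (of_real (b' t) * of_real (c t) + of_real (b t) * of_real (c' t))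
       * (dt f (t, x) - (- \<i>) * of_real (V t x) * f (t, x))
     + 4 * of_real (b t) * of_real (c t) * (dt (dt f) (t, x)
         - (- \<i>) * (of_real (V_t t x) * f (t, x) + of_real (V t x) * dt f (t, x)))
     + 2 * (of_real (b' t) * of_real (v t x) + of_real (c' t) * of_real (u t x)
         - 2 * of_real (b t) * of_real (c t) * of_real (V_x t x)) * dx f (t, x)
     + 2 * (of_real (b t) * of_real (v t x) + of_real (c t) * of_real (u t x)) * dt (dx f) (t, x)
     + (2 * of_real (b' t) * of_real (c' t) - 4 * of_real (g2 t) * of_real (b t) * of_real (c t)
         - 2 * (- \<i>) * of_real (V_x t x)
             * (of_real (b t) * of_real (v t x) + of_real (c t) * of_real (u t x))) * f (t, x)
     + (of_real (b' t) * of_real (c t) + of_real (b t) * of_real (c' t)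
         + 2 * (- \<i>) * of_real (u t x) * of_real (v t x)) * dt f (t, x)) (at t)"
proof -
  have b': "(b has_real_derivative b' t) (at t)" "(b' has_real_derivative - 2 * g2 t * b t) (at t)"
      "((\<lambda>\<tau>. u \<tau> x) has_real_derivative - b t * V_x t x) (at t)"
    and c': "(c has_real_derivative c' t) (at t)" "(c' has_real_derivative - 2 * g2 t * c t) (at t)"
      "((\<lambda>\<tau>. v \<tau> x) has_real_derivative - c t * V_x t x) (at t)"
    using b c by (auto simp: symbol_def)
  note f' = has_vector_derivative_dt[OF f] has_vector_derivative_dt[OF smooth_on_dt[OF f(1)] f(2)]
    has_vector_derivative_dt[OF smooth_on_dx[OF f(1)] f(2)]
  show ?thesis unfolding symbol_op_def case_prod_conv
    by (rule derivative_eq_intros b' c' f' V_t refl)+ (simp add: algebra_simps)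
qed

lemma symbol_op_dx:
  assumes f: "smooth_on U f" "(t, x) \<in> U" and b: "symbol b b' u" and c: "symbol c c' v"
  shows "((\<lambda>\<xi>. symbol_op b b' u c c' v f (t, \<xi>)) has_vector_derivative
     4 * of_real (b t) * of_real (c t) * (dx (dt f) (t, x)
         - (- \<i>) * (of_real (V_x t x) * f (t, x) + of_real (V t x) * dx f (t, x)))
     + 2 * (of_real (b' t) * of_real (c t) + of_real (b t) * of_real (c' t)) * dx f (t, x)
     + 2 * (of_real (b t) * of_real (v t x) + of_real (c t) * of_real (u t x)) * dx (dx f) (t, x)
     + 2 * (- \<i>) * (of_real (b' t) * of_real (v t x) + of_real (c' t) * of_real (u t x)) * f (t, x)
     + (of_real (b' t) * of_real (c t) + of_real (b t) * of_real (c' t)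
         + 2 * (- \<i>) * of_real (u t x) * of_real (v t x)) * dx f (t, x)) (at x)"
proof -
  have b': "(u t has_real_derivative b' t) (at x)" and c': "(v t has_real_derivative c' t) (at x)"
    using b c by (auto simp: symbol_def)
  note f' = has_vector_derivative_dx[OF f] has_vector_derivative_dx[OF smooth_on_dt[OF f(1)] f(2)]
    has_vector_derivative_dx[OF smooth_on_dx[OF f(1)] f(2)]
  show ?thesis unfolding symbol_op_def case_prod_conv
    by (rule derivative_eq_intros b' c' f' V_x refl)+ (simp add: algebra_simps)
qed

text \<open>The two derivatives are supplied as data, so that \<open>g\<close> may itself be an
  image under \<open>symbol_op\<close>, with derivatives taken from \<open>symbol_op_dt\<close> and
  \<open>symbol_op_dx\<close>.\<close>

lemma symbol_op_apply:
  assumes "((\<lambda>\<tau>. g (\<tau>, x)) has_vector_derivative g_t) (at t)"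
    and "((\<lambda>\<xi>. g (t, \<xi>)) has_vector_derivative g_x) (at x)"
  shows "symbol_op b b' u c c' v g (t, x) =
     4 * of_real (b t) * of_real (c t) * (g_t - (- \<i>) * of_real (V t x) * g (t, x))
     + 2 * (of_real (b t) * of_real (v t x) + of_real (c t) * of_real (u t x)) * g_x
     + (of_real (b' t) * of_real (c t) + of_real (b t) * of_real (c' t)
         + 2 * (- \<i>) * of_real (u t x) * of_real (v t x)) * g (t, x)"
  using assms by (simp add: symbol_op_def dt_def dx_def vector_derivative_at)

lemma symbol_op_scale:
  assumes "((\<lambda>\<tau>. g (\<tau>, x)) has_vector_derivative g_t) (at t)"
    and "((\<lambda>\<xi>. g (t, \<xi>)) has_vector_derivative g_x) (at x)"
  shows "symbol_op b b' u c c' v (\<lambda>p. k * g p) (t, x) = k * symbol_op b b' u c c' v g (t, x)"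
  unfolding symbol_op_apply[OF assms]
    symbol_op_apply[where g = "\<lambda>p. k * g p", OF assms[THEN has_vector_derivative_mult_right]]
  by (simp add: algebra_simps)

text \<open>In terms of \<open>4 K\<^sub>j\<^sub>k\<close> the left side is \<open>16
  (K\<^sub>1\<^sub>2 K\<^sub>1\<^sub>2 - K\<^sub>1\<^sub>2 - K\<^sub>2\<^sub>2
  K\<^sub>1\<^sub>1)\<close>, that is, eight times the Casimir element.\<close>

lemma casimir_symbol_op:
  assumes U: "open U" "(t, x) \<in> U" and f: "smooth_on U f"
    and b: "symbol b b' u" and c: "symbol c c' v"
    and W: "b t * c' t - c t * b' t = 1"
  shows "symbol_op b b' u c c' v (symbol_op b b' u c c' v f) (t, x)
           - 4 * symbol_op b b' u c c' v f (t, x)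
           - symbol_op c c' v c c' v (symbol_op b b' u b b' u f) (t, x)
         = 4 * of_real (b t * v t x - c t * u t x) ^ 2 * schroedinger V f (t, x) - 3 * f (t, x)"
proof -
  have W': "complex_of_real (b t) * of_real (c' t) - of_real (c t) * of_real (b' t) = 1"
    using W by (metis of_real_1 of_real_diff of_real_mult)
  note inner = symbol_op_apply[OF has_vector_derivative_dt[OF f U(2)] has_vector_derivative_dx[OF f U(2)]]
  \<comment> \<open>Symmetry replaces \<open>dx (dt f)\<close> by \<open>dt (dx f)\<close>, since
    the identity has a single variable \<open>ftx\<close> for both.\<close>
  note outer1 = symbol_op_apply[OF symbol_op_dt[OF f U(2) b b] symbol_op_dx[OF f U(2) b b],
      unfolded inner mixed_partials_eq[OF U f]]
  note outer2 = symbol_op_apply[OF symbol_op_dt[OF f U(2) b c] symbol_op_dx[OF f U(2) b c],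
      unfolded inner mixed_partials_eq[OF U f]]
  \<comment> \<open>For this \<sigma>,
    \<open>4 * fxx - 8 * \<sigma> * (ft - \<sigma> * V * f)\<close> is four times the Schroedinger
    operator applied to \<open>f\<close>.\<close>
  note identity = casimir_identity[where b = "of_real (b t)" and c = "of_real (c t)"
      and b' = "of_real (b' t)" and c' = "of_real (c' t)" and u = "of_real (u t x)" and v = "of_real (v t x)"
      and \<sigma> = "- \<i>" and V = "of_real (V t x)" and Vt = "of_real (V_t t x)" and Vx = "of_real (V_x t x)"
      and g = "of_real (g2 t)" and f = "f (t, x)" and ft = "dt f (t, x)" and fx = "dx f (t, x)"
      and ftt = "dt (dt f) (t, x)" and ftx = "dt (dx f) (t, x)" and fxx = "dx (dx f) (t, x)",
      unfolded W']
  show ?thesis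
    unfolding outer1 outer2 inner
    by (rule trans[OF _ trans[OF identity]])
      (simp_all add: schroedinger_def box_def algebra_simps)
qed

end


section \<open>Quadratic potentials and the operators \<open>L\<^sub>j\<close>\<close>

locale quadratic_potential =
  fixes g0 g1 g2 :: "real \<Rightarrow> real"
  assumes smooth_g: "smooth_real g0" "smooth_real g1" "smooth_real g2"
begin

abbreviation quad :: "real \<Rightarrow> real \<Rightarrow> real" where
  "quad t x \<equiv> g2 t * x\<^sup>2 + g1 t * x + g0 t"

sublocale potential quad "\<lambda>t x. deriv g2 t * x\<^sup>2 + deriv g1 t * x + deriv g0 t"
    "\<lambda>t x. 2 * g2 t * x + g1 t" g2
  by unfold_locales
    (auto intro!: derivative_eq_intros smooth_g[THEN smooth_real_has_real_derivative])

definition momentum :: "(real \<Rightarrow> real) \<Rightarrow> (real \<Rightarrow> real) \<Rightarrow> real \<Rightarrow> real \<Rightarrow> real" where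
  "momentum b b' t x = b' t * x - intC g1 b t"

lemma continuous_g: "continuous_on A g0" "continuous_on A g1" "continuous_on A g2"
  using smooth_g[THEN smooth_real_has_real_derivative]
  by (meson DERIV_continuous_on DERIV_subset subset_UNIV)+

lemma intC_derivative:
  assumes "\<And>t. (b has_real_derivative b' t) (at t)"
  shows "(intC g1 b has_real_derivative b t * g1 t) (at t)"
  using assms by (intro has_real_derivative_intC continuous_g)
    (meson DERIV_continuous_on DERIV_subset subset_UNIV)

text \<open>The time derivative of \<open>b' x - intC g1 b\<close> is
  \<open>- 2 g2 b x - b g1\<close>, which is \<open>- b\<close> times the
  \<open>x\<close>-derivative of \<open>quad\<close>.\<close>

lemma symbol_momentum:
  assumes "\<And>t. (b has_real_derivative b' t) (at t)"
    and "\<And>t. (b' has_real_derivative - 2 * g2 t * b t) (at t)"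
  shows "symbol b b' (momentum b b')"
  unfolding symbol_def momentum_def
  by (intro allI conjI assms;
      ((rule derivative_eq_intros assms intC_derivative refl)+, simp add: algebra_simps))

text \<open>The zeroth-order coefficient is \<open>k (b c)' / 4 + i k (b c quad - u v / 2)\<close>.
  Expanding the bracket in powers of \<open>x\<close> gives the terms with \<open>phi''\<close>,
  with \<open>coeffA'\<close>, and with \<open>g0 phi + coeffD\<close>. The factor \<open>k\<close>
  is 1 for the two squares and 2 for \<open>j = 3\<close>.\<close>

lemma opL_eq_symbol_op:
  assumes b: "\<And>t. (b has_real_derivative b' t) (at t)"
      "\<And>t. (b' has_real_derivative - 2 * g2 t * b t) (at t)"
    and c: "\<And>t. (c has_real_derivative c' t) (at t)"
      "\<And>t. (c' has_real_derivative - 2 * g2 t * c t) (at t)"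
    and phi: "phi \<chi>1 \<chi>2 j = (\<lambda>t. k * (b t * c t))"
    and A: "coeffA g1 \<chi>1 \<chi>2 j = (\<lambda>t. - (k / 2) * (b t * intC g1 c t + c t * intC g1 b t))"
    and D: "\<And>t. coeffD g1 \<chi>1 \<chi>2 j t = - (k / 2) * (intC g1 b t * intC g1 c t)"
  shows "opL g0 g1 \<chi>1 \<chi>2 j f = (\<lambda>p. (-1) ^ (j + 1) * of_real (k / 4)
           * symbol_op b b' (momentum b b') c c' (momentum c c') f p)"
proof -
  have phi': "deriv (phi \<chi>1 \<chi>2 j) = (\<lambda>t. k * (b' t * c t + b t * c' t))"
    unfolding phi
    by (intro ext DERIV_imp_deriv) (auto intro!: derivative_eq_intros b c simp: algebra_simps)
  have phi'': "deriv (deriv (phi \<chi>1 \<chi>2 j)) = (\<lambda>t. k * (2 * b' t * c' t - 4 * g2 t * b t * c t))"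
    unfolding phi'
    by (intro ext DERIV_imp_deriv) (auto intro!: derivative_eq_intros b c simp: algebra_simps)
  have A': "deriv (coeffA g1 \<chi>1 \<chi>2 j)
      = (\<lambda>t. - (k / 2) * (b' t * intC g1 c t + c' t * intC g1 b t + 2 * b t * c t * g1 t))"
    unfolding A
    by (intro ext DERIV_imp_deriv)
      (auto intro!: derivative_eq_intros b c intC_derivative[OF b(1)] intC_derivative[OF c(1)]
        simp: field_simps)
  show ?thesis
    unfolding opL_def coeffB_def phi'' A'
    unfolding phi' symbol_op_def momentum_def fun_eq_iff
    by (auto simp: phi A D field_simps power2_eq_square)
qed

lemma casimir_eq_schroedinger:
  assumes U: "open U" "(t, x) \<in> U" and f: "smooth_on U f"
    and sol: "solves_ode2 g2 \<chi>1" "solves_ode2 g2 \<chi>2" and W: "wronskian \<chi>1 \<chi>2 t = 1"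
  shows "casimir (sl2_act g0 g1 \<chi>1 \<chi>2) f (t, x) =
    (1/2) * (of_real (x - \<chi>1 t * intC g1 \<chi>2 t + \<chi>2 t * intC g1 \<chi>1 t) ^ 2
       * schroedinger quad f (t, x) - (3/4) * f (t, x))"
proof -
  obtain b where b: "\<And>t. (\<chi>1 has_real_derivative b t) (at t)"
      "\<And>t. (b has_real_derivative - 2 * g2 t * \<chi>1 t) (at t)"
    using sol(1) unfolding solves_ode2_def by blast
  obtain c where c: "\<And>t. (\<chi>2 has_real_derivative c t) (at t)"
      "\<And>t. (c has_real_derivative - 2 * g2 t * \<chi>2 t) (at t)"
    using sol(2) unfolding solves_ode2_def by blast
  note sb = symbol_momentum[OF b] and sc = symbol_momentum[OF c]
  let ?u = "momentum \<chi>1 b" and ?v = "momentum \<chi>2 c"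
  let ?S11 = "symbol_op \<chi>1 b ?u \<chi>1 b ?u" and ?S12 = "symbol_op \<chi>1 b ?u \<chi>2 c ?v"
    and ?S22 = "symbol_op \<chi>2 c ?v \<chi>2 c ?v"
  have W': "\<chi>1 t * c t - \<chi>2 t * b t = 1"
    using W by (simp add: wronskian_def b(1)[THEN DERIV_imp_deriv] c(1)[THEN DERIV_imp_deriv])
  have L1: "opL g0 g1 \<chi>1 \<chi>2 1 h = (\<lambda>p. (1/4) * ?S11 h p)" for h
    by (subst opL_eq_symbol_op[OF b b, where k = 1])
      (auto simp: phi_def coeffA_def coeffD_def power2_eq_square fun_eq_iff)
  have L2: "opL g0 g1 \<chi>1 \<chi>2 2 h = (\<lambda>p. - (1/4) * ?S22 h p)" for h
    by (subst opL_eq_symbol_op[OF c c, where k = 1])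
      (auto simp: phi_def coeffA_def coeffD_def power2_eq_square fun_eq_iff)
  have L3: "opL g0 g1 \<chi>1 \<chi>2 3 h = (\<lambda>p. (1/2) * ?S12 h p)" for h
    by (subst opL_eq_symbol_op[OF b c, where k = 2])
      (auto simp: phi_def coeffA_def coeffD_def power2_eq_square fun_eq_iff)
  \<comment> \<open>The constants \<open>1/2\<close>, \<open>1/4\<close> and \<open>- 1/4\<close> in
    \<open>L3\<close>, \<open>L1\<close> and \<open>L2\<close> turn \<open>h\<^sup>2 / 2\<close>,
    \<open>- h\<close> and \<open>2 e\<^sup>+ e\<^sup>-\<close> into the weights \<open>1/8\<close>,
    \<open>- 4/8\<close> and \<open>- 1/8\<close>.\<close>
  have "casimir (sl2_act g0 g1 \<chi>1 \<chi>2) f (t, x)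
      = (1/8) * (?S12 (?S12 f) (t, x) - 4 * ?S12 f (t, x) - ?S22 (?S11 f) (t, x))"
    unfolding casimir_def sl2_act_triple L1 L2 L3
      symbol_op_scale[OF symbol_op_dt[OF f U(2) sb sc] symbol_op_dx[OF f U(2) sb sc]]
      symbol_op_scale[OF symbol_op_dt[OF f U(2) sb sb] symbol_op_dx[OF f U(2) sb sb]]
    by (simp add: algebra_simps)
  also have "\<dots> = (1/8) * (4 * of_real (\<chi>1 t * ?v t x - \<chi>2 t * ?u t x) ^ 2
      * schroedinger quad f (t, x) - 3 * f (t, x))"
    by (subst casimir_symbol_op[OF U f sb sc W']) simp
  also have "\<chi>1 t * ?v t x - \<chi>2 t * ?u t x
      = (\<chi>1 t * c t - \<chi>2 t * b t) * x - \<chi>1 t * intC g1 \<chi>2 t + \<chi>2 t * intC g1 \<chi>1 t"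
    by (simp add: momentum_def algebra_simps)
  finally show ?thesis by (simp add: W' algebra_simps)
qed

lemma continuous_on_schroedinger:
  assumes "smooth_on U f"
  shows "continuous_on U (schroedinger quad f)"
proof -
  have "continuous_on U (\<lambda>p. g (fst p))" if "continuous_on UNIV g" for g :: "real \<Rightarrow> real"
    by (rule continuous_on_compose2[OF that]) (auto intro: continuous_intros)
  note g = continuous_g[THEN this]
  show ?thesis
    unfolding schroedinger_def box_def split_beta prod.collapse
    by (intro continuous_intros smooth_on_continuous smooth_on_dt smooth_on_dx assms g)
qed

end

section \<open>Kernels and the inverse-square term\<close>

text \<open>A point of the graph is approached along the line of constant \<open>t\<close>: nearby
  points stay in the open set \<open>U\<close> and lie off the graph, so the limit of
  \<open>h\<close> is 0.\<close>

lemma zero_off_graph_imp_zero: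
  fixes h :: "real \<times> real \<Rightarrow> complex"
  assumes U: "open U" "(t, x) \<in> U" and h: "continuous_on U h"
    and zero: "\<And>t x. (t, x) \<in> U \<Longrightarrow> x \<noteq> y t \<Longrightarrow> h (t, x) = 0"
  shows "h (t, x) = 0"
proof (cases "x = y t")
  case True
  have "isCont h (t, x)" using U h continuous_on_eq_continuous_at by blast
  moreover have T: "((\<lambda>\<xi>. (t, \<xi>)) \<longlongrightarrow> (t, x)) (at x)" by (intro tendsto_intros)
  ultimately have lim: "((\<lambda>\<xi>. h (t, \<xi>)) \<longlongrightarrow> h (t, x)) (at x)" by (rule isCont_tendsto_compose)
  have "\<forall>\<^sub>F \<xi> in at x. (t, \<xi>) \<in> U" using T U by (rule topological_tendstoD)
  then have "\<forall>\<^sub>F \<xi> in at x. h (t, \<xi>) = 0"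
    using eventually_neq_at_within[of x x UNIV] by eventually_elim (use True zero in auto)
  then have "((\<lambda>\<xi>. h (t, \<xi>)) \<longlongrightarrow> 0) (at x)" by (rule tendsto_eventually)
  then show ?thesis using lim by (intro tendsto_unique[of "at x"]) auto
qed (use U zero in blast)

theorem corollary4:
  fixes g0 g1 g2 \<chi>1 \<chi>2 :: "real \<Rightarrow> real"
    and r :: complex
    and U :: "(real \<times> real) set"
    and I :: "wavefun set"
  assumes smooth_g: "smooth_real g0" "smooth_real g1" "smooth_real g2"
    and sol: "solves_ode2 g2 \<chi>1" "solves_ode2 g2 \<chi>2"
    and indep: "lin_indep \<chi>1 \<chi>2"
    and wronskian: "\<And>t. wronskian \<chi>1 \<chi>2 t = 1"
    and r: "r = - 1 / 2"
    and U: "open U"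
    and I: "smooth_function_space U I"
    and stable: "\<And>j f. j \<in> {1, 2, 3} \<Longrightarrow> f \<in> I \<Longrightarrow> opL g0 g1 \<chi>1 \<chi>2 j f \<in> I"
  shows
    "(\<forall>f\<in>I. \<forall>(t, x)\<in>U.
        casimir (sl2_act g0 g1 \<chi>1 \<chi>2) f (t, x) =
          (1/2) * (of_real (x - \<chi>1 t * intC g1 \<chi>2 t + \<chi>2 t * intC g1 \<chi>1 t) ^ 2
                     * schroedinger (\<lambda>t x. g2 t * x\<^sup>2 + g1 t * x + g0 t) f (t, x)
                   - (3/4) * f (t, x)))
     \<and> ker_on U I (casimir' r (sl2_act g0 g1 \<chi>1 \<chi>2))
         = ker_on U I (schroedinger (\<lambda>t x. g2 t * x\<^sup>2 + g1 t * x + g0 t))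
     \<and> (\<forall>lam::real. lam \<noteq> 0 \<and> (\<forall>t. g1 t = 0) \<longrightarrow>
          (\<forall>f\<in>I. \<forall>(t, x)\<in>U.
             casimir' r (sl2_act g0 g1 \<chi>1 \<chi>2) f (t, x) =
               of_real x ^ 2 * schroedinger (\<lambda>t x. g2 t * x\<^sup>2 + g0 t) f (t, x))
          \<and> ker_on U I (\<lambda>f p. casimir' r (sl2_act g0 g1 \<chi>1 \<chi>2) f p
                                - 2 * of_real lam * f p)
              = ker_on (U \<inter> {(t, x). x \<noteq> 0}) I
                  (schroedinger (\<lambda>t x. g2 t * x\<^sup>2 + g0 t + lam / x\<^sup>2)))"
proof -
  interpret quadratic_potential g0 g1 g2 using smooth_g by unfold_locales
  let ?y = "\<lambda>t. \<chi>1 t * intC g1 \<chi>2 t - \<chi>2 t * intC g1 \<chi>1 t"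
  let ?C = "casimir (sl2_act g0 g1 \<chi>1 \<chi>2)" and ?C' = "casimir' r (sl2_act g0 g1 \<chi>1 \<chi>2)"
  have smooth: "smooth_on U f" if "f \<in> I" for f
    using I that by (simp add: smooth_function_space_def)
  have C: "?C f (t, x) = (1/2) * (of_real (x - \<chi>1 t * intC g1 \<chi>2 t + \<chi>2 t * intC g1 \<chi>1 t) ^ 2
      * schroedinger quad f (t, x) - (3/4) * f (t, x))" if "f \<in> I" "(t, x) \<in> U" for f t x
    using casimir_eq_schroedinger[OF U that(2) smooth[OF that(1)] sol wronskian] .
  \<comment> \<open>Here \<open>r * (r + 2) = - 3/4\<close> cancels the constant term of twice the
    Casimir element.\<close>
  have C': "?C' f (t, x) = of_real (x - ?y t) ^ 2 * schroedinger quad f (t, x)"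
    if "f \<in> I" "(t, x) \<in> U" for f t x
    unfolding casimir'_def C[OF that] r by (simp add: algebra_simps)
  have ker: "ker_on U I ?C' = ker_on U I (schroedinger quad)"
  proof -
    have "schroedinger quad f (t, x) = 0"
      if f: "f \<in> I" and z: "\<forall>p\<in>U. ?C' f p = 0" and p: "(t, x) \<in> U" for f t x
    proof (rule zero_off_graph_imp_zero[OF U p continuous_on_schroedinger[OF smooth[OF f]]])
      show "schroedinger quad f (t, x) = 0" if "(t, x) \<in> U" "x \<noteq> ?y t" for t x
      proof -
        have "complex_of_real (x - ?y t) \<noteq> 0" using that(2) by (subst of_real_eq_0_iff) simp
        then show ?thesis using C'[OF f that(1)] z that(1) by simp
      qed
    qed
    then show ?thesis by (auto simp: ker_on_def C')
  qed
  have inverse_square: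
    "(\<forall>f\<in>I. \<forall>(t, x)\<in>U. ?C' f (t, x) =
        of_real x ^ 2 * schroedinger (\<lambda>t x. g2 t * x\<^sup>2 + g0 t) f (t, x))
     \<and> ker_on U I (\<lambda>f p. ?C' f p - 2 * of_real lam * f p)
       = ker_on (U \<inter> {(t, x). x \<noteq> 0}) I (schroedinger (\<lambda>t x. g2 t * x\<^sup>2 + g0 t + lam / x\<^sup>2))"
    if g1: "\<forall>t. g1 t = 0" for lam
  proof -
    let ?S = "schroedinger (\<lambda>t x. g2 t * x\<^sup>2 + g0 t)"
      and ?Sl = "schroedinger (\<lambda>t x. g2 t * x\<^sup>2 + g0 t + lam / x\<^sup>2)"
    have quad: "quad = (\<lambda>t x. g2 t * x\<^sup>2 + g0 t)" using g1 by simp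
    have "intC g1 b t = 0" for b t using g1 by (simp add: intC_def)
    then have C'0: "?C' f (t, x) = of_real x ^ 2 * ?S f (t, x)" if "f \<in> I" "(t, x) \<in> U" for f t x
      using C'[OF that] by (simp add: quad)
    \<comment> \<open>\<open>?H f\<close> is \<open>x\<^sup>2\<close> times \<open>?Sl f\<close>
      with the singular term cleared. It is continuous across \<open>x = 0\<close>, where
      \<open>lam / x\<^sup>2\<close> only has the default value 0.\<close>
    let ?H = "\<lambda>f p. of_real (snd p) ^ 2 * ?S f p - 2 * of_real lam * f p"
    have H: "?H f (t, x) = of_real x ^ 2 * ?Sl f (t, x)" if "x \<noteq> 0" for f t x
      using that by (simp add: schroedinger_def field_simps)
    \<comment> \<open>The kernel of \<open>?Sl\<close> imposes nothing at \<open>x = 0\<close>;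
      continuity supplies the missing condition there, which reads
      \<open>lam * f (t, 0) = 0\<close>.\<close>
    have H0: "?H f (t, x) = 0"
      if f: "f \<in> I" and z: "\<forall>p\<in>U \<inter> {(t, x). x \<noteq> 0}. ?Sl f p = 0" and p: "(t, x) \<in> U" for f t x
    proof (rule zero_off_graph_imp_zero[OF U p, where y = "\<lambda>_. 0"])
      show "continuous_on U (?H f)"
        using continuous_on_schroedinger[OF smooth[OF f]] smooth_on_continuous[OF smooth[OF f]]
        unfolding quad by (intro continuous_intros)
      show "?H f (t, x) = 0" if "(t, x) \<in> U" "x \<noteq> 0" for t x
        using H[OF that(2)] z that by simp
    qed
    have "f \<in> ker_on U I (\<lambda>f p. ?C' f p - 2 * of_real lam * f p)
        \<longleftrightarrow> f \<in> ker_on (U \<inter> {(t, x). x \<noteq> 0}) I ?Sl" for f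
    proof (cases "f \<in> I")
      case True
      have "(\<forall>p\<in>U. ?C' f p - 2 * of_real lam * f p = 0) \<longleftrightarrow> (\<forall>(t, x)\<in>U. ?H f (t, x) = 0)"
        using C'0[OF True] by (auto simp: split_beta)
      also have "\<dots> \<longleftrightarrow> (\<forall>p\<in>U \<inter> {(t, x). x \<noteq> 0}. ?Sl f p = 0)"
        using H[where f = f] H0[OF True] by fastforce
      finally show ?thesis using True by (simp add: ker_on_def)
    qed (simp add: ker_on_def)
    then show ?thesis using C'0 by blast
  qed
  show ?thesis using C ker inverse_square by blast
qed

end
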